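(* Let $\mathcal{L}=(L,\wedge,\vee,0,1)$ be a complete lattice and let $X\subseteq L\setminus\{1\}$. If $(X,\tau^{\mathfrak{fp}})$ is compact, then $(X,\tau^{cl})$ is spectral.
   Context: For $a\in L$ put $V(a)=\{p\in X\mid a\le p\}$. The classical Zariski topology $\tau^{cl}$ on $X$ is the topology having $\{X\setminus V(a)\mid a\in L\}$ as a subbase. The finer patch topology $\tau^{\mathfrak{fp}}$ on $X$ is the topology having $\{V(a)\cap (X\setminus V(b))\mid a,b\in L\}$ as a subbase. Compact means that every open cover has a finite subcover (no separation axiom is assumed). A topological space is spectral iff it is homeomorphic to the prime spectrum $Spec(R)$ of a commutative ring $R$ with the Zariski topology; by Hochster's characterization this is equivalent to being compact, sober (every irreducible closed subset has a unique generic point), and having a basis of compact open sets closed under finite intersections. *)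

theory Defs
  imports "HOL-Analysis.Analysis" "HOL-Algebra.Ideal"
begin

section \<open>Prime spectra and spectral spaces\<close>

definition prime_spectrum :: "('r, 'm) ring_scheme \<Rightarrow> 'r set set" where
  "prime_spectrum R = {P. primeideal P R}"

text \<open>The closed sets are the sets of primes containing a given \<open>E \<subseteq> carrier R\<close>; that this is a
  topology is proved in \<open>openin_zariski\<close>.\<close>

definition zariski :: "('r, 'm) ring_scheme \<Rightarrow> 'r set topology" where
  "zariski R = topology (\<lambda>U. \<exists>E \<subseteq> carrier R. U = prime_spectrum R - {P \<in> prime_spectrum R. E \<subseteq> P})"

lemma istopology_zariski:
  assumes "cring R"
  shows "istopology (\<lambda>U. \<exists>E \<subseteq> carrier R. U = prime_spectrum R - {P \<in> prime_spectrum R. E \<subseteq> P})"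
    (is "istopology ?T")
  unfolding istopology_def
proof (intro conjI allI impI)
  interpret cring R by fact
  fix U V assume "?T U" "?T V"
  then obtain E F where E: "E \<subseteq> carrier R" "U = prime_spectrum R - {P \<in> prime_spectrum R. E \<subseteq> P}"
    and F: "F \<subseteq> carrier R" "V = prime_spectrum R - {P \<in> prime_spectrum R. F \<subseteq> P}" by blast
  define G where "G = {x \<otimes>\<^bsub>R\<^esub> y | x y. x \<in> E \<and> y \<in> F}"
  have G: "G \<subseteq> carrier R" using E F by (auto simp: G_def)
  have "G \<subseteq> P \<longleftrightarrow> E \<subseteq> P \<or> F \<subseteq> P" if P: "primeideal P R" for P
  proof
    interpret primeideal P R by fact
    show "E \<subseteq> P \<or> F \<subseteq> P" if GP: "G \<subseteq> P"
    proof (rule ccontr)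
      assume "\<not> (E \<subseteq> P \<or> F \<subseteq> P)"
      then obtain x y where "x \<in> E" "x \<notin> P" "y \<in> F" "y \<notin> P" by blast
      moreover from this have "x \<otimes>\<^bsub>R\<^esub> y \<in> P" using GP by (auto simp: G_def)
      ultimately show False using I_prime E(1) F(1) by blast
    qed
    show "G \<subseteq> P" if "E \<subseteq> P \<or> F \<subseteq> P"
      using that E(1) F(1) I_l_closed I_r_closed unfolding G_def by blast
  qed
  then have "U \<inter> V = prime_spectrum R - {P \<in> prime_spectrum R. G \<subseteq> P}"
    using E F by (auto simp: prime_spectrum_def)
  with G show "?T (U \<inter> V)" by blast
next
  fix K assume "\<forall>U\<in>K. ?T U"
  define e where "e = (\<lambda>U. SOME E. E \<subseteq> carrier R \<and> U = prime_spectrum R - {P \<in> prime_spectrum R. E \<subseteq> P})"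
  have e: "e U \<subseteq> carrier R \<and> prime_spectrum R - {P \<in> prime_spectrum R. e U \<subseteq> P} = U" if "U \<in> K" for U
    using someI_ex[OF \<open>\<forall>U\<in>K. ?T U\<close>[rule_format, OF that]] unfolding e_def by (auto simp only:)
  have "\<Union>(e ` K) \<subseteq> carrier R" using e by blast
  moreover have "prime_spectrum R - {P \<in> prime_spectrum R. \<Union>(e ` K) \<subseteq> P} =
      (\<Union>U\<in>K. prime_spectrum R - {P \<in> prime_spectrum R. e U \<subseteq> P})" by blast
  then have "\<Union>K = prime_spectrum R - {P \<in> prime_spectrum R. \<Union>(e ` K) \<subseteq> P}" using e by simp
  ultimately show "?T (\<Union>K)" by blast
qed

lemma openin_zariski:
  assumes "cring R"
  shows "openin (zariski R) U \<longleftrightarrow>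
    (\<exists>E \<subseteq> carrier R. U = prime_spectrum R - {P \<in> prime_spectrum R. E \<subseteq> P})"
  unfolding zariski_def using topology_inverse'[OF istopology_zariski[OF assms]] by simp

lemma topspace_zariski:
  assumes "cring R"
  shows "topspace (zariski R) = prime_spectrum R"
proof
  show "topspace (zariski R) \<subseteq> prime_spectrum R"
    using openin_zariski[OF assms] openin_topspace by blast
  interpret cring R by fact
  have "\<not> carrier R \<subseteq> P" if "P \<in> prime_spectrum R" for P
    using that primeideal.I_notcarr[of P R] ideal.Icarr[of P R] primeideal.axioms(1)[of P R]
    unfolding prime_spectrum_def by blast
  then have "openin (zariski R) (prime_spectrum R)"
    unfolding openin_zariski[OF assms] by blast
  then show "prime_spectrum R \<subseteq> topspace (zariski R)" by (rule openin_subset)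
qed

text \<open>HOL cannot quantify over the carrier type of the ring, so a type must be chosen that is large
  enough for every space with points in \<open>'p\<close>. By Hochster's construction a spectral space \<open>T\<close> is
  the spectrum of some ring with at most \<open>max \<aleph>\<^sub>0 \<kappa>\<close> elements, \<open>\<kappa>\<close> being the number of compact open
  sets of \<open>T\<close>; the type below, having at least as many elements as \<open>'p set\<close> and being infinite,
  contains a copy of it. Hence the restriction to this type does not change the notion.\<close>

definition spectral_space :: "'p topology \<Rightarrow> bool" where
  "spectral_space T \<longleftrightarrow>
    (\<exists>R :: ('p + nat) list set ring. cring R \<and> T homeomorphic_space zariski R)"


section \<open>The two topologies on a subset of a complete lattice\<close>

definition closed_V :: "'a::complete_lattice set \<Rightarrow> 'a \<Rightarrow> 'a set" where
  "closed_V X a = {p \<in> X. a \<le> p}"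

text \<open>\<^const>\<open>topology_generated_by\<close> takes the union of the subbase as the underlying space. If \<open>X\<close>
  does not contain the top element, this union is \<open>X\<close> in both cases below. The greatest element is
  written \<open>top_class.top\<close> because \<open>top\<close> alone denotes a constant of \<^theory>\<open>HOL-Algebra.Order\<close>.\<close>

definition classical_zariski_topology :: "'a::complete_lattice set \<Rightarrow> 'a topology" where
  "classical_zariski_topology X = topology_generated_by {X - closed_V X a | a. True}"

definition patch_topology :: "'a::complete_lattice set \<Rightarrow> 'a topology" where
  "patch_topology X = topology_generated_by {closed_V X a \<inter> (X - closed_V X b) | a b. True}"

lemma topspace_classical_zariski_topology:
  assumes "X \<subseteq> UNIV - {top_class.top}"
  shows "topspace (classical_zariski_topology X) = X"
proof -
  have "X - closed_V X top_class.top = X" using assms by (auto simp: closed_V_def top_unique)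
  then show ?thesis unfolding classical_zariski_topology_def by auto
qed

lemma topspace_patch_topology:
  assumes "X \<subseteq> UNIV - {top_class.top}"
  shows "topspace (patch_topology X) = X"
proof -
  have "closed_V X bot \<inter> (X - closed_V X top_class.top) = X" using assms by (auto simp: closed_V_def top_unique)
  then show ?thesis unfolding patch_topology_def by auto
qed

end

theory Submission
  imports Defs
    "HOL-Algebra.Weak_Morphisms"
    "HOL-Library.Multiset_Order"
    "HOL-Library.Poly_Mapping"
    "HOL-Computational_Algebra.Polynomial"
    "HOL-Computational_Algebra.Fraction_Field"
begin

text \<open>
  The ring is a ring of functions on \<open>X\<close>, and the primes are the vanishing ideals of the points. In
  the classical topology the closure of \<open>p\<close> consists of the \<open>q \<in> X\<close> with \<open>p \<le> q\<close>. Let \<open>F\<close> be the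
  fraction field of \<open>\<int>[T\<^sub>a | a \<in> L]\<close>. Every \<open>q\<close> gives a partial limit operation on \<open>F\<close>: replace \<open>T\<^sub>a\<close>
  by \<open>s T\<^sub>a\<close> for all \<open>a \<le> q\<close> and let \<open>s\<close> tend to \<open>0\<close> (\<open>specializes\<close>). The ring consists of the
  functions \<open>f : X \<rightarrow> F\<close> that are continuous from the patch topology to the discrete one and for which
  the limit of \<open>f p\<close> at \<open>q\<close> is \<open>f q\<close> whenever \<open>p \<le> q\<close> (\<open>hochster_functions\<close>).

  \<^item> The cozero set of such an \<open>f\<close> is clopen in the patch topology and contains \<open>p\<close> as soon as it
    contains some \<open>q \<ge> p\<close>; by compactness of the patch topology it is open in the classical one
    (\<open>openin_classical_if_patch_closed_complement\<close>). The set \<open>X - V(a)\<close> is the cozero set of the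
    function that is \<open>T\<^sub>a\<close> on it and \<open>0\<close> elsewhere. So cozero sets form a basis.
  \<^item> If \<open>f\<close> vanishes wherever \<open>g\<close> does, then \<open>g\<close> divides a power of \<open>f\<close>
    (\<open>hochster_functions_power_divide\<close>). Indeed, \<open>f ^ n / g\<close> has the right limits once \<open>n\<close> exceeds the
    orders in \<open>s\<close> of the scaled values of \<open>g\<close>. These orders are bounded by degrees of polynomials,
    uniformly in \<open>q\<close>, and \<open>g\<close> has only finitely many values because \<open>X\<close> is compact.
  \<^item> The union of two cozero sets is the cozero set of a combination \<open>f + n g\<close> with an integer \<open>n\<close>,
    since only finitely many quotients of values have to be avoided (\<open>cozero_join\<close>).

  These properties force the primes to be points (\<open>prime_is_point_prime\<close>). For a prime \<open>Q\<close>, the zero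
  sets of the members of \<open>Q\<close> and the cozero sets of the non-members are closed in the patch
  topology, and the last two properties show that finitely many of them always meet. By compactness
  they have a common point \<open>p\<close>, and \<open>Q\<close> consists of the functions that vanish at \<open>p\<close>.

  It remains to move the ring to the carrier type in the definition of a spectral space. A polynomial
  is determined by its coefficients at words in the variables, so functions into \<open>F\<close> can be encoded
  as sets of words (\<open>inj_function_code\<close>).
\<close>

section \<open>Rings with a support map\<close>

text \<open>\<open>D x\<close> plays the role of the set of points at which \<open>x\<close> does not vanish. The axioms
  \<open>support_subset_imp_dvd_power\<close> and \<open>support_join\<close> say that inclusions and unions of supports are
  visible in the ring; together with the compactness of \<open>P\<close>, in which supports are clopen, they exclude primes
  that do not come from points.\<close>

locale ring_support = cring R for R (structure) +
  fixes D :: "'r \<Rightarrow> 'p set" and T P :: "'p topology"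
  assumes support_zero: "D \<zero> = {}"
    and support_one: "D \<one> = topspace T"
    and support_mult: "\<lbrakk>x \<in> carrier R; y \<in> carrier R\<rbrakk> \<Longrightarrow> D (x \<otimes> y) = D x \<inter> D y"
    and support_add: "\<lbrakk>x \<in> carrier R; y \<in> carrier R\<rbrakk> \<Longrightarrow> D (x \<oplus> y) \<subseteq> D x \<union> D y"
    and support_subset_imp_dvd_power: "\<lbrakk>x \<in> carrier R; y \<in> carrier R; D x \<subseteq> D y\<rbrakk>
      \<Longrightarrow> \<exists>n::nat. \<exists>z\<in>carrier R. x [^] n = y \<otimes> z"
    and support_join: "\<lbrakk>x \<in> carrier R; y \<in> carrier R\<rbrakk>
      \<Longrightarrow> \<exists>c\<in>carrier R. D (x \<oplus> c \<otimes> y) = D x \<union> D y"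
    and support_open: "x \<in> carrier R \<Longrightarrow> openin T (D x)"
    and support_basis: "\<lbrakk>openin T U; p \<in> U\<rbrakk> \<Longrightarrow> \<exists>x\<in>carrier R. p \<in> D x \<and> D x \<subseteq> U"
    and support_separates: "\<lbrakk>p \<in> topspace T; q \<in> topspace T; p \<noteq> q\<rbrakk>
      \<Longrightarrow> \<exists>x\<in>carrier R. (p \<in> D x) \<noteq> (q \<in> D x)"
    and compact: "compact_space P"
    and support_closed: "x \<in> carrier R \<Longrightarrow> closedin P (D x)"
    and support_complement_closed: "x \<in> carrier R \<Longrightarrow> closedin P (topspace T - D x)"
begin

definition point_prime :: "'p \<Rightarrow> 'r set" where
  "point_prime p = {x \<in> carrier R. p \<notin> D x}"

lemma primeideal_point_prime:
  assumes p: "p \<in> topspace T"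
  shows "primeideal (point_prime p) R"
proof (rule primeidealI2)
  show "cring R" by (rule is_cring)
  have minus: "D (\<ominus> x) \<subseteq> D x" if x: "x \<in> carrier R" for x
  proof -
    have "\<ominus> x = (\<ominus> \<one>) \<otimes> x" using x by (simp add: l_minus)
    then show ?thesis using support_mult[of "\<ominus> \<one>" x] x by auto
  qed
  have "subgroup (point_prime p) (add_monoid R)"
  proof (rule add.subgroupI)
    show "point_prime p \<subseteq> carrier R" by (auto simp: point_prime_def)
    show "point_prime p \<noteq> {}" using support_zero zero_closed by (auto simp: point_prime_def)
    show "\<ominus> x \<in> point_prime p" if "x \<in> point_prime p" for x
      using that minus[of x] a_inv_closed[of x] unfolding point_prime_def by blast
    show "x \<oplus> y \<in> point_prime p" if "x \<in> point_prime p" "y \<in> point_prime p" for x y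
      using that support_add[of x y] a_closed[of x y] unfolding point_prime_def by blast
  qed
  then show "additive_subgroup (point_prime p) R" by (rule additive_subgroup.intro)
  show "carrier R \<noteq> point_prime p"
    using p support_one one_closed by (auto simp: point_prime_def)
qed (auto simp: point_prime_def support_mult)

text \<open>A prime \<open>Q\<close> prescribes at which elements a point should vanish. Finitely many of these conditions
  reduce to a single pair \<open>f \<in> Q\<close>, \<open>g \<notin> Q\<close>: supports of members of \<open>Q\<close> are joined inside \<open>Q\<close>, and
  non-members are multiplied. Such a pair is satisfied by some point, for otherwise \<open>D g \<subseteq> D f\<close>
  puts a power of \<open>g\<close> into \<open>Q\<close>. Compactness of \<open>P\<close> then satisfies all conditions at once.\<close>

lemma prime_is_point_prime:
  assumes Q: "primeideal Q R"
  shows "\<exists>p\<in>topspace T. Q = point_prime p"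
proof -
  interpret Q: primeideal Q R by (rule Q)
  have one: "\<one> \<notin> Q" using Q.I_notcarr Q.one_imp_carrier by metis
  have pow: "x [^] (n::nat) \<notin> Q" if "x \<in> carrier R" "x \<notin> Q" for x n
  proof (induction n)
    case (Suc n)
    have "x [^] n \<otimes> x \<notin> Q" using that Suc.IH Q.I_prime[of "x [^] n" x] nat_pow_closed by blast
    then show ?case by (simp only: nat_pow_Suc not_False_eq_True)
  qed (simp only: nat_pow_0 one not_False_eq_True)
  define C where "C = (\<lambda>f. topspace T - D f) ` Q \<union> D ` (carrier R - Q)"
  have closed: "\<forall>A\<in>C. closedin P A"
    unfolding C_def using support_closed support_complement_closed Q.Icarr by blast
  have D_le: "D g \<subseteq> topspace T" if "g \<in> carrier R" for g
    using support_open[OF that] by (rule openin_subset)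
  have fip: "\<exists>f\<in>Q. \<exists>g\<in>carrier R - Q. D g - D f \<subseteq> \<Inter>F" if "finite F" "F \<subseteq> C" for F
    using that
  proof (induction F)
    case empty
    show ?case using one Q.zero_closed by blast
  next
    case (insert A F)
    then obtain f g where fg: "f \<in> Q" "g \<in> carrier R - Q" "D g - D f \<subseteq> \<Inter>F" by auto
    from insert.prems consider h where "h \<in> Q" "A = topspace T - D h"
      | h where "h \<in> carrier R - Q" "A = D h"
      unfolding C_def by blast
    then show ?case
    proof cases
      case 1
      obtain c where c: "c \<in> carrier R" "D (f \<oplus> c \<otimes> h) = D f \<union> D h"
        using support_join[of f h] fg(1) 1(1) Q.Icarr by blast
      have "f \<oplus> c \<otimes> h \<in> Q"
        using fg(1) 1(1) c(1) Q.I_l_closed Q.a_closed by blast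
      moreover have "D g - D (f \<oplus> c \<otimes> h) \<subseteq> \<Inter>(insert A F)"
        using c(2) fg(2,3) 1(2) D_le[of g] by blast
      ultimately show ?thesis using fg(2) by blast
    next
      case 2
      have "g \<otimes> h \<in> carrier R - Q" using fg(2) 2(1) Q.I_prime[of g h] m_closed by blast
      moreover have "D (g \<otimes> h) - D f \<subseteq> \<Inter>(insert A F)"
        using fg(2,3) 2 support_mult[of g h] by blast
      ultimately show ?thesis using fg(1) by blast
    qed
  qed
  have "\<Inter>F \<noteq> {}" if F: "finite F" "F \<subseteq> C" for F
  proof
    assume "\<Inter>F = {}"
    then obtain f g where fg: "f \<in> Q" "g \<in> carrier R" "g \<notin> Q" "D g \<subseteq> D f"
      using fip[OF F] by (metis DiffE Diff_eq_empty_iff subset_empty)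
    then obtain n :: nat and z where "z \<in> carrier R" "g [^] n = f \<otimes> z"
      using support_subset_imp_dvd_power[of g f] Q.Icarr by blast
    then show False using pow[of g n] fg Q.I_r_closed[of f z] by metis
  qed
  then have "\<Inter>C \<noteq> {}"
    using compact[unfolded compact_space_fip, rule_format, of C] closed by metis
  then obtain p where p: "p \<in> \<Inter>C" by blast
  have on: "p \<in> D g" if "g \<in> carrier R" "g \<notin> Q" for g
    using p that unfolding C_def by blast
  have off: "p \<notin> D f" if "f \<in> Q" for f
    using p that unfolding C_def by blast
  have "p \<in> topspace T" using on[OF one_closed one] support_one by simp
  moreover have "Q = point_prime p"
    using on off Q.Icarr unfolding point_prime_def by blast
  ultimately show ?thesis by blast
qed

lemma homeomorphic_space_zariski: "T homeomorphic_space zariski R"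
proof -
  let ?Z = "zariski R"
  have surj: "point_prime ` topspace T = prime_spectrum R"
    using primeideal_point_prime prime_is_point_prime by (auto simp: prime_spectrum_def)
  have inj: "inj_on point_prime (topspace T)"
  proof (rule inj_onI, rule ccontr)
    fix p q assume pq: "p \<in> topspace T" "q \<in> topspace T" "point_prime p = point_prime q" "p \<noteq> q"
    then obtain x where "x \<in> carrier R" "(p \<in> D x) \<noteq> (q \<in> D x)" using support_separates by blast
    then show False using pq(3) by (auto simp: point_prime_def)
  qed
  have basic: "{p \<in> topspace T. \<not> E \<subseteq> point_prime p} = \<Union>(D ` E)" if E: "E \<subseteq> carrier R" for E
  proof -
    have "D x \<subseteq> topspace T" if "x \<in> E" for x
      using support_open E that openin_subset by blast
    then show ?thesis using E by (auto simp: point_prime_def)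
  qed
  have "homeomorphic_map T ?Z point_prime"
  proof (rule bijective_open_imp_homeomorphic_map)
    show "point_prime ` topspace T = topspace ?Z"
      using surj topspace_zariski[OF is_cring] by simp
    show "inj_on point_prime (topspace T)" by (rule inj)
    show "continuous_map T ?Z point_prime"
      unfolding continuous_map_def
    proof (intro conjI allI impI)
      show "point_prime \<in> topspace T \<rightarrow> topspace ?Z"
        using surj topspace_zariski[OF is_cring] by auto
      fix U assume "openin ?Z U"
      then obtain E where E: "E \<subseteq> carrier R"
        "U = prime_spectrum R - {Q \<in> prime_spectrum R. E \<subseteq> Q}"
        unfolding openin_zariski[OF is_cring] by blast
      have "{p \<in> topspace T. point_prime p \<in> U} = {p \<in> topspace T. \<not> E \<subseteq> point_prime p}"
        using E(2) surj by auto
      also have "\<dots> = \<Union>(D ` E)" by (rule basic[OF E(1)])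
      also have "openin T \<dots>" using support_open E(1) by (intro openin_Union) auto
      finally show "openin T {p \<in> topspace T. point_prime p \<in> U}" .
    qed
    show "open_map T ?Z point_prime"
      unfolding open_map_def
    proof (intro allI impI)
      fix U assume U: "openin T U"
      define E where "E = {x \<in> carrier R. D x \<subseteq> U}"
      have E: "E \<subseteq> carrier R" by (auto simp: E_def)
      have "U = \<Union>(D ` E)" using support_basis[OF U] by (auto simp: E_def)
      then have "U = {p \<in> topspace T. \<not> E \<subseteq> point_prime p}" using basic[OF E] by simp
      then have "point_prime ` U = prime_spectrum R - {Q \<in> prime_spectrum R. E \<subseteq> Q}"
        using surj by auto
      then show "openin ?Z (point_prime ` U)" unfolding openin_zariski[OF is_cring] using E by blast
    qed
  qed
  then show ?thesis by (rule homeomorphic_map_imp_homeomorphic_space)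
qed

text \<open>The axioms survive transport of structure. This permits the ring to be built on a convenient type
  and moved to another one afterwards.\<close>

lemma ring_support_image_ring:
  assumes inj: "inj_on h (carrier R)"
  shows "ring_support (image_ring h R) (\<lambda>s. D (inv_into (carrier R) h s)) T P"
proof -
  let ?S = "image_ring h R"
  have iso: "h \<in> ring_iso R ?S" by (rule inj_imp_image_ring_iso[OF inj])
  have "cring (?S\<lparr>zero := h \<zero>\<rparr>)" by (rule ring_iso_imp_img_cring[OF iso])
  then have S: "cring ?S" by (simp add: image_ring_def image_group_def monoid.defs)
  have hom: "h \<in> ring_hom R ?S" using iso by (simp add: ring_iso_def)
  interpret S: cring ?S by (rule S)
  interpret h: ring_hom_cring R ?S h
    by (intro ring_hom_cring.intro ring_hom_cring_axioms.intro is_cring S hom)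
  have carrier: "carrier ?S = h ` carrier R" by (rule image_ring_carrier)
  have D: "D (inv_into (carrier R) h (h x)) = D x" if "x \<in> carrier R" for x
    using inj that by simp
  show ?thesis
  proof (intro ring_support.intro ring_support_axioms.intro S, unfold carrier)
    show "D (inv_into (carrier R) h \<zero>\<^bsub>?S\<^esub>) = {}"
      using D[OF zero_closed] by (simp add: support_zero)
    show "D (inv_into (carrier R) h \<one>\<^bsub>?S\<^esub>) = topspace T"
      using D[OF one_closed] by (simp add: support_one)
  next
    fix s t assume "s \<in> h ` carrier R" "t \<in> h ` carrier R"
    then obtain x y where x: "x \<in> carrier R" "s = h x" and y: "y \<in> carrier R" "t = h y" by blast
    show "D (inv_into (carrier R) h (s \<otimes>\<^bsub>?S\<^esub> t)) =
        D (inv_into (carrier R) h s) \<inter> D (inv_into (carrier R) h t)"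
      using x y D[of "x \<otimes> y"] by (simp add: D support_mult)
    show "D (inv_into (carrier R) h (s \<oplus>\<^bsub>?S\<^esub> t)) \<subseteq>
        D (inv_into (carrier R) h s) \<union> D (inv_into (carrier R) h t)"
      using x y D[of "x \<oplus> y"] support_add[of x y] by (simp add: D)
    show "\<exists>n::nat. \<exists>z\<in>h ` carrier R. s [^]\<^bsub>?S\<^esub> n = t \<otimes>\<^bsub>?S\<^esub> z"
      if "D (inv_into (carrier R) h s) \<subseteq> D (inv_into (carrier R) h t)"
    proof -
      have "D x \<subseteq> D y" using that x y by (simp add: D)
      then obtain n :: nat and z where z: "z \<in> carrier R" "x [^] n = y \<otimes> z"
        using support_subset_imp_dvd_power[OF x(1) y(1)] by blast
      have "s [^]\<^bsub>?S\<^esub> n = h (x [^] n)" by (induction n) (use x in simp_all)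
      then show ?thesis using x y z by auto
    qed
    show "\<exists>c\<in>h ` carrier R. D (inv_into (carrier R) h (s \<oplus>\<^bsub>?S\<^esub> c \<otimes>\<^bsub>?S\<^esub> t)) =
        D (inv_into (carrier R) h s) \<union> D (inv_into (carrier R) h t)"
    proof -
      obtain c where c: "c \<in> carrier R" "D (x \<oplus> c \<otimes> y) = D x \<union> D y"
        using support_join[OF x(1) y(1)] by blast
      have "s \<oplus>\<^bsub>?S\<^esub> h c \<otimes>\<^bsub>?S\<^esub> t = h (x \<oplus> c \<otimes> y)" using x y c by simp
      then show ?thesis using x y c D[of "x \<oplus> c \<otimes> y"] by (auto simp: D)
    qed
  next
    fix s assume "s \<in> h ` carrier R"
    then obtain x where x: "x \<in> carrier R" "s = h x" by blast
    show "openin T (D (inv_into (carrier R) h s))"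
      and "closedin P (D (inv_into (carrier R) h s))"
      and "closedin P (topspace T - D (inv_into (carrier R) h s))"
      using x by (simp_all add: D support_open support_closed support_complement_closed)
  next
    fix U p assume "openin T U" "p \<in> U"
    from support_basis[OF this]
    show "\<exists>s\<in>h ` carrier R. p \<in> D (inv_into (carrier R) h s) \<and> D (inv_into (carrier R) h s) \<subseteq> U"
      by (auto simp: D)
  next
    fix p q assume "p \<in> topspace T" "q \<in> topspace T" "p \<noteq> q"
    from support_separates[OF this]
    show "\<exists>s\<in>h ` carrier R. (p \<in> D (inv_into (carrier R) h s)) \<noteq> (q \<in> D (inv_into (carrier R) h s))"
      by (auto simp: D)
  qed (rule compact)
qed

end

section \<open>Classical and patch topology\<close>

lemma openin_classical_subbase: "openin (classical_zariski_topology X) (X - closed_V X a)"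
  unfolding classical_zariski_topology_def by (intro topology_generated_by_Basis) auto

lemma openin_patch_subbase:
  "openin (patch_topology X) (closed_V X a \<inter> (X - closed_V X b))"
  unfolding patch_topology_def by (intro topology_generated_by_Basis) auto

lemma patch_clopen_V:
  assumes X: "X \<subseteq> UNIV - {top_class.top}"
  shows "openin (patch_topology X) (closed_V X a)"
    and "openin (patch_topology X) (X - closed_V X a)"
proof -
  have V: "closed_V X a \<inter> (X - closed_V X top_class.top) = closed_V X a"
    and W: "closed_V X bot \<inter> (X - closed_V X a) = X - closed_V X a"
    using X by (auto simp: closed_V_def top_unique)
  show "openin (patch_topology X) (closed_V X a)"
    using openin_patch_subbase[of X a top_class.top] unfolding V .
  show "openin (patch_topology X) (X - closed_V X a)"
    using openin_patch_subbase[of X bot a] unfolding W .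
qed

text \<open>If \<open>q \<in> U\<close> and \<open>p \<in> X - U\<close>, then \<open>p \<le> q\<close> fails, so \<open>q\<close> lies outside \<open>V(p)\<close>, which is a patch
  neighbourhood of \<open>p\<close>. Finitely many of these neighbourhoods cover \<open>X - U\<close>, and the intersection of
  their complements is a classical neighbourhood of \<open>q\<close> inside \<open>U\<close>.\<close>

lemma openin_classical_if_patch_closed_complement:
  assumes X: "X \<subseteq> UNIV - {top_class.top}"
    and compact: "compact_space (patch_topology X)"
    and closed: "closedin (patch_topology X) (X - U)"
    and U: "U \<subseteq> X"
    and generization: "\<And>p q. \<lbrakk>p \<in> X; q \<in> U; p \<le> q\<rbrakk> \<Longrightarrow> p \<in> U"
  shows "openin (classical_zariski_topology X) U"
proof (subst openin_subopen, intro ballI)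
  fix q assume q: "q \<in> U"
  have "compactin (patch_topology X) (X - U)"
    using closedin_compact_space[OF compact closed] .
  then have "\<exists>F. finite F \<and> F \<subseteq> closed_V X ` (X - U) \<and> X - U \<subseteq> \<Union>F"
    by (rule compactinD) (auto intro: patch_clopen_V(1)[OF X], auto simp: closed_V_def)
  then obtain F where F: "finite F" "F \<subseteq> closed_V X ` (X - U)" "X - U \<subseteq> \<Union>F" by blast
  then obtain Z where Z: "Z \<subseteq> X - U" "finite Z" "F = closed_V X ` Z"
    by (meson finite_subset_image)
  \<comment> \<open>Intersecting with \<open>X\<close> matters when \<open>Z\<close> is empty.\<close>
  let ?N = "X \<inter> (\<Inter>p\<in>Z. X - closed_V X p)"
  have "openin (classical_zariski_topology X) ?N"
    using Z(2)
  proof (induction Z)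
    case empty
    show ?case
      using openin_topspace[of "classical_zariski_topology X"] topspace_classical_zariski_topology[OF X] by simp
  next
    case (insert z Z)
    have "X \<inter> (\<Inter>p\<in>insert z Z. X - closed_V X p) = (X - closed_V X z) \<inter> (X \<inter> (\<Inter>p\<in>Z. X - closed_V X p))"
      by blast
    then show ?case using openin_Int[OF openin_classical_subbase insert.IH] by metis
  qed
  moreover have "q \<in> ?N" using q U Z(1) generization by (auto simp: closed_V_def)
  moreover have "?N \<subseteq> U" using F(3) Z(3) by auto
  ultimately show "\<exists>T. openin (classical_zariski_topology X) T \<and> q \<in> T \<and> T \<subseteq> U" by blast
qed

section \<open>Polynomials with one variable for each lattice element\<close>

text \<open>A copy of the type \<open>'a\<close> that carries a linear order, obtained from a well-ordering. The order
  makes the multisets of variables a linearly ordered cancellative monoid, so that the polynomials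
  below form an integral domain.\<close>

typedef 'a variable = "UNIV :: 'a set" by simp

instantiation variable :: (type) linorder
begin

definition variable_order :: "'a variable rel" where
  "variable_order = (SOME r. well_order_on UNIV r)"

definition less_eq_variable :: "'a variable \<Rightarrow> 'a variable \<Rightarrow> bool" where
  "x \<le> y \<longleftrightarrow> (x, y) \<in> variable_order"

definition less_variable :: "'a variable \<Rightarrow> 'a variable \<Rightarrow> bool" where
  "x < y \<longleftrightarrow> x \<le> y \<and> \<not> y \<le> x" for x y :: "'a variable"

instance
proof
  have "well_order_on UNIV (variable_order :: 'a variable rel)"
    unfolding variable_order_def by (rule someI_ex) (rule well_order_on)
  then have ord: "refl (variable_order :: 'a variable rel)" "trans (variable_order :: 'a variable rel)"
      "antisym (variable_order :: 'a variable rel)" "total (variable_order :: 'a variable rel)"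
    by (simp_all add: order_on_defs well_order_on_def)
  fix x y z :: "'a variable"
  show "x < y \<longleftrightarrow> x \<le> y \<and> \<not> y \<le> x" by (rule less_variable_def)
  show "x \<le> x" using ord(1) by (simp add: less_eq_variable_def refl_on_def)
  show "x \<le> z" if "x \<le> y" "y \<le> z" using ord(2) that by (auto simp: less_eq_variable_def elim: transE)
  show "x = y" if "x \<le> y" "y \<le> x" using ord(3) that by (auto simp: less_eq_variable_def dest: antisymD)
  show "x \<le> y \<or> y \<le> x" using ord(1,4) by (cases "x = y") (auto simp: less_eq_variable_def total_on_def refl_on_def)
qed

end

type_synonym 'a mpoly = "'a variable multiset \<Rightarrow>\<^sub>0 int"

definition weight :: "'a set \<Rightarrow> 'a variable multiset \<Rightarrow> nat" where
  "weight S m = size (filter_mset (\<lambda>v. Rep_variable v \<in> S) m)"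

lemma weight_add: "weight S (m + n) = weight S m + weight S n"
  by (simp add: weight_def)

lemma weight_le_size: "weight S m \<le> size m"
  by (simp add: weight_def size_filter_mset_lesseq)

text \<open>The substitution that multiplies the variables in \<open>S\<close> by a new variable \<open>s\<close>. The result is
  regarded as a polynomial in \<open>s\<close> over the original polynomials, so that its order at \<open>0\<close> is the
  order of vanishing along the variables in \<open>S\<close>.\<close>

definition scale :: "'a set \<Rightarrow> 'a mpoly \<Rightarrow> 'a mpoly poly" where
  "scale S A = (\<Sum>m\<in>Poly_Mapping.keys A.
     Polynomial.monom (Poly_Mapping.single m (Poly_Mapping.lookup A m)) (weight S m))"

lemma scale_superset:
  assumes "finite M" "Poly_Mapping.keys A \<subseteq> M"
  shows "scale S A = (\<Sum>m\<in>M. Polynomial.monom (Poly_Mapping.single m (Poly_Mapping.lookup A m)) (weight S m))"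
  unfolding scale_def
  by (rule sum.mono_neutral_left) (use assms in \<open>auto simp: in_keys_iff\<close>)

lemma scale_add: "scale S (A + B) = scale S A + scale S B"
proof -
  let ?M = "Poly_Mapping.keys A \<union> Poly_Mapping.keys B"
  have "Poly_Mapping.keys (A + B) \<subseteq> ?M" by (rule Poly_Mapping.keys_add)
  then show ?thesis
    by (simp add: scale_superset[of ?M] lookup_add single_add add_monom[symmetric] sum.distrib)
qed

lemma scale_single: "scale S (Poly_Mapping.single m c) = Polynomial.monom (Poly_Mapping.single m c) (weight S m)"
  by (subst scale_superset[of "{m}"]) auto

lemma scale_zero [simp]: "scale S 0 = 0" by (simp add: scale_def)

lemma mpoly_induct [case_names zero add]:
  fixes A :: "'a mpoly"
  assumes "Q 0" "\<And>A m c. Q A \<Longrightarrow> Q (Poly_Mapping.single m c + A)"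
  shows "Q A"
proof (induction A rule: update_induct)
  case const
  then show ?case by (rule assms(1))
next
  case (update f a b)
  have "Poly_Mapping.update a b f = Poly_Mapping.single a b + f"
    using update(1) by (intro poly_mapping_eqI)
      (auto simp: update.rep_eq lookup_add lookup_single when_def in_keys_iff)
  then show ?case using assms(2) update by metis
qed

lemma scale_mult: "scale S (A * B) = scale S A * scale S B"
proof (induction A rule: mpoly_induct)
  case (add A m c)
  have "scale S (Poly_Mapping.single m c * B) = scale S (Poly_Mapping.single m c) * scale S B"
    by (induction B rule: mpoly_induct)
      (simp_all add: scale_add distrib_left mult_single scale_single mult_monom weight_add)
  then show ?case using add by (simp add: distrib_right scale_add)
qed simp

text \<open>Setting \<open>s = 1\<close> undoes the substitution, which is therefore injective.\<close>

lemma scale_at_one: "poly (scale S A) 1 = A"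
  by (induction A rule: mpoly_induct) (simp_all add: scale_add scale_single poly_monom)

lemma scale_eq_0_iff [simp]: "scale S A = 0 \<longleftrightarrow> A = 0"
  using scale_at_one[of S A] by auto

lemma scale_one [simp]: "scale S 1 = 1"
  using scale_single[of S 0 1] by (simp add: weight_def monom_eq_1_iff)

lemma scale_uminus: "scale S (- A) = - scale S A"
  using scale_add[of S "- A" A] by (simp add: eq_neg_iff_add_eq_0)

lemma scale_power: "scale S (A ^ n) = scale S A ^ n"
  by (induction n) (simp_all add: scale_mult)

lemma scale_of_nat: "scale S (of_nat n) = of_nat n"
  by (induction n) (simp_all add: scale_add)

text \<open>The bound does not depend on \<open>S\<close>: the degree in \<open>s\<close> is at most the total degree. This is what
  later makes one exponent work for all points of \<open>X\<close>.\<close>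

lemma degree_scale_bounded: "\<exists>N. \<forall>S. Polynomial.degree (scale S A) \<le> N"
proof (induction A rule: mpoly_induct)
  case (add A m c)
  then obtain N where N: "Polynomial.degree (scale S A) \<le> N" for S by blast
  have "Polynomial.degree (scale S (Poly_Mapping.single m c + A)) \<le> max (size m) N" for S
    unfolding scale_add scale_single
    by (intro order.trans[OF degree_add_le_max] max.mono N
        order.trans[OF Polynomial.degree_monom_le] weight_le_size)
  then show ?case by blast
qed simp

section \<open>Specialization in the field of rational functions\<close>

text \<open>\<open>specializes S x y\<close> means that \<open>y\<close> is the value at \<open>s = 0\<close> of the rational function obtained from \<open>x\<close>
  by scaling the variables in \<open>S\<close> with \<open>s\<close>: the largest power of \<open>s\<close> that divides the scaled
  denominator is cancelled, and then \<open>s\<close> is set to \<open>0\<close>. In other words, \<open>x\<close> belongs to the valuation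
  ring of the order along \<open>S\<close>, and \<open>y\<close> represents its residue.\<close>

definition specializes :: "'a set \<Rightarrow> 'a mpoly fract \<Rightarrow> 'a mpoly fract \<Rightarrow> bool" where
  "specializes S x y \<longleftrightarrow> (\<exists>A B A' B' k. x = Fract A B \<and>
     scale S A = [:0, 1:] ^ k * A' \<and> scale S B = [:0, 1:] ^ k * B' \<and>
     poly B' 0 \<noteq> 0 \<and> y = Fract (poly A' 0) (poly B' 0))"

lemma specializesI:
  assumes "x = Fract A B" "scale S A = [:0, 1:] ^ k * A'" "scale S B = [:0, 1:] ^ k * B'"
    "poly B' 0 \<noteq> 0" "y = Fract (poly A' 0) (poly B' 0)"
  shows "specializes S x y"
  using assms unfolding specializes_def by blast

lemma specializesE:
  assumes "specializes S x y"
  obtains A B A' B' k where "x = Fract A B" "B \<noteq> 0"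
    "scale S A = [:0, 1:] ^ k * A'" "scale S B = [:0, 1:] ^ k * B'"
    "poly B' 0 \<noteq> 0" "y = Fract (poly A' 0) (poly B' 0)"
proof -
  obtain A B A' B' k where *: "x = Fract A B"
    "scale S A = [:0, 1:] ^ k * A'" "scale S B = [:0, 1:] ^ k * B'"
    "poly B' 0 \<noteq> 0" "y = Fract (poly A' 0) (poly B' 0)"
    using assms unfolding specializes_def by blast
  have "scale S B \<noteq> 0" using * by auto
  then have "B \<noteq> 0" by simp
  then show ?thesis using that * by blast
qed

lemma specializes_add:
  assumes "specializes S x y" "specializes S u v"
  shows "specializes S (x + u) (y + v)"
proof -
  from assms(1) obtain A B A' B' k where 1: "x = Fract A B" "B \<noteq> 0"
    "scale S A = [:0, 1:] ^ k * A'" "scale S B = [:0, 1:] ^ k * B'"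
    "poly B' 0 \<noteq> 0" "y = Fract (poly A' 0) (poly B' 0)" by (rule specializesE)
  from assms(2) obtain C E C' E' l where 2: "u = Fract C E" "E \<noteq> 0"
    "scale S C = [:0, 1:] ^ l * C'" "scale S E = [:0, 1:] ^ l * E'"
    "poly E' 0 \<noteq> 0" "v = Fract (poly C' 0) (poly E' 0)" by (rule specializesE)
  show ?thesis
  proof (rule specializesI)
    show "x + u = Fract (A * E + C * B) (B * E)" using 1 2 by simp
    show "scale S (A * E + C * B) = [:0, 1:] ^ (k + l) * (A' * E' + C' * B')"
      unfolding scale_add scale_mult 1 2 power_add by (simp only: ring_distribs ac_simps)
    show "scale S (B * E) = [:0, 1:] ^ (k + l) * (B' * E')"
      unfolding scale_mult 1 2 power_add by (simp only: ring_distribs ac_simps)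
    show "poly (B' * E') 0 \<noteq> 0" using 1 2 by simp
    show "y + v = Fract (poly (A' * E' + C' * B') 0) (poly (B' * E') 0)" using 1 2 by simp
  qed
qed

lemma specializes_mult:
  assumes "specializes S x y" "specializes S u v"
  shows "specializes S (x * u) (y * v)"
proof -
  from assms(1) obtain A B A' B' k where 1: "x = Fract A B" "B \<noteq> 0"
    "scale S A = [:0, 1:] ^ k * A'" "scale S B = [:0, 1:] ^ k * B'"
    "poly B' 0 \<noteq> 0" "y = Fract (poly A' 0) (poly B' 0)" by (rule specializesE)
  from assms(2) obtain C E C' E' l where 2: "u = Fract C E" "E \<noteq> 0"
    "scale S C = [:0, 1:] ^ l * C'" "scale S E = [:0, 1:] ^ l * E'"
    "poly E' 0 \<noteq> 0" "v = Fract (poly C' 0) (poly E' 0)" by (rule specializesE)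
  show ?thesis
  proof (rule specializesI)
    show "x * u = Fract (A * C) (B * E)" using 1 2 by simp
    show "scale S (A * C) = [:0, 1:] ^ (k + l) * (A' * C')"
      unfolding scale_mult 1 2 power_add by (simp only: ring_distribs ac_simps)
    show "scale S (B * E) = [:0, 1:] ^ (k + l) * (B' * E')"
      unfolding scale_mult 1 2 power_add by (simp only: ring_distribs ac_simps)
    show "poly (B' * E') 0 \<noteq> 0" using 1 2 by simp
    show "y * v = Fract (poly (A' * C') 0) (poly (B' * E') 0)" using 1 2 by simp
  qed
qed

lemma specializes_inverse:
  assumes "specializes S x y" "y \<noteq> 0"
  shows "specializes S (inverse x) (inverse y)"
proof -
  from assms(1) obtain A B A' B' k where 1: "x = Fract A B" "B \<noteq> 0"
    "scale S A = [:0, 1:] ^ k * A'" "scale S B = [:0, 1:] ^ k * B'"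
    "poly B' 0 \<noteq> 0" "y = Fract (poly A' 0) (poly B' 0)" by (rule specializesE)
  show ?thesis
  proof (rule specializesI)
    show "poly A' 0 \<noteq> 0" using assms(2) 1 by (auto simp: fract_collapse)
  qed (use 1 in auto)
qed

lemma specializes_constant:
  assumes "scale S A = [:A:]"
  shows "specializes S (Fract A 1) (Fract A 1)"
  by (rule specializesI[where k = 0]) (use assms in auto)

lemma specializes_of_nat: "specializes S (of_nat n) (of_nat n)"
  unfolding of_nat_fract
  by (rule specializes_constant) (simp add: scale_of_nat of_nat_poly)

lemma specializes_zero: "specializes S 0 0" and specializes_one: "specializes S 1 1"
  using specializes_of_nat[of S 0] specializes_of_nat[of S 1] by simp_all

lemma specializes_uminus:
  assumes "specializes S x y" 
  shows "specializes S (- x) (- y)"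
proof -
  have "specializes S (- 1) (- 1)"
    using specializes_constant[of S "- 1"]
    by (simp add: One_fract_def scale_uminus one_pCons)
  from specializes_mult[OF this assms] show ?thesis by simp
qed

lemma specializes_zero_iff: "specializes S 0 y \<longleftrightarrow> y = 0"
proof
  assume "specializes S 0 y"
  then obtain A B A' B' k where 1: "0 = Fract A B" "B \<noteq> 0"
    "scale S A = [:0, 1:] ^ k * A'" "scale S B = [:0, 1:] ^ k * B'"
    "poly B' 0 \<noteq> 0" "y = Fract (poly A' 0) (poly B' 0)" by (rule specializesE)
  from 1(1,2) have "A = 0" by (simp add: Zero_fract_def eq_fract)
  then have "A' = 0" using 1(3) by simp
  then show "y = 0" using 1 by (simp add: fract_collapse)
qed (simp add: specializes_zero)

text \<open>If \<open>x\<close> has positive order along \<open>S\<close>, then \<open>x ^ n\<close> has order at least \<open>n\<close>, and \<open>n\<close> only has to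
  exceed the order of \<open>y\<close>. The latter is at most the degree of a numerator of \<open>y\<close>, whatever \<open>S\<close> is.\<close>

lemma eventually_power_divide_specializes_zero:
  assumes "y \<noteq> 0"
  shows "\<exists>N. \<forall>n>N. \<forall>S x. specializes S x 0 \<longrightarrow> specializes S (x ^ n / y) 0"
proof -
  obtain C E where y: "y = Fract C E" "E \<noteq> 0" "C \<noteq> 0"
    using assms by (cases y rule: Fract_cases_nonzero) auto
  obtain N where N: "Polynomial.degree (scale S C) \<le> N" for S
    using degree_scale_bounded[of C] by blast
  have "specializes S (x ^ n / y) 0" if n: "n > N" and x: "specializes S x 0" for S x n
  proof -
    from x obtain A B A' B' k where 1: "x = Fract A B" "B \<noteq> 0"
      "scale S A = [:0, 1:] ^ k * A'" "scale S B = [:0, 1:] ^ k * B'"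
      "poly B' 0 \<noteq> 0" "0 = Fract (poly A' 0) (poly B' 0)" by (rule specializesE)
    from 1(5,6) have "poly A' 0 = 0" by (simp add: Zero_fract_def eq_fract)
    \<comment> \<open>\<open>c\<close> is the order of the numerator of \<open>y\<close>; it may exceed that of \<open>y\<close>.\<close>
    define c where "c = Polynomial.order 0 (scale S C)"
    have "scale S C \<noteq> 0" using y by simp
    from order_decomp[OF this, of 0] obtain C' where C':
      "scale S C = [:0, 1:] ^ c * C'" "\<not> [:0, 1:] dvd C'"
      unfolding c_def by auto
    then have C'0: "poly C' 0 \<noteq> 0" using poly_eq_0_iff_dvd[of C' 0] by simp
    have "c \<le> N" unfolding c_def
      using order_degree[OF \<open>scale S C \<noteq> 0\<close>, of 0] N[of S] by simp
    with n obtain d where d: "n = c + Suc d" using less_iff_Suc_add[of c n] by auto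
    obtain A'' where A'': "A' = [:0, 1:] * A''"
      using \<open>poly A' 0 = 0\<close> poly_eq_0_iff_dvd[of A' 0] by auto
    have pow: "Fract A B ^ m = Fract (A ^ m) (B ^ m)" for m
      by (induction m) (simp_all add: One_fract_def)
    have Xn: "[:0, 1 :: 'a mpoly:] ^ n = [:0, 1:] ^ c * [:0, 1:] ^ Suc d"
      unfolding d power_add ..
    show ?thesis
    proof (rule specializesI)
      show "x ^ n / y = Fract (A ^ n * E) (B ^ n * C)"
        unfolding 1 y pow by simp
      show "scale S (A ^ n * E) = [:0, 1:] ^ (k * n + c) * ([:0, 1:] ^ Suc d * A'' ^ n * scale S E)"
        unfolding scale_mult scale_power 1 A'' power_mult_distrib power_mult power_add
        by (simp only: ac_simps Xn)
      show "scale S (B ^ n * C) = [:0, 1:] ^ (k * n + c) * (B' ^ n * C')"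
        unfolding scale_mult scale_power 1 C' power_mult_distrib power_mult[symmetric] power_add
        by (simp only: ac_simps)
      show "poly (B' ^ n * C') 0 \<noteq> 0" using 1(5) C'0 by simp
      show "0 = Fract (poly ([:0, 1:] ^ Suc d * A'' ^ n * scale S E) 0) (poly (B' ^ n * C') 0)"
        by (simp add: fract_collapse)
    qed
  qed
  then show ?thesis by blast
qed

definition var :: "'a \<Rightarrow> 'a mpoly fract" where
  "var a = Fract (Poly_Mapping.single {#Abs_variable a#} 1) 1"

lemma var_nonzero: "var a \<noteq> 0"
proof -
  have "Poly_Mapping.single {#Abs_variable a#} (1::int) \<noteq> 0"
    by (metis lookup_single_eq lookup_zero zero_neq_one)
  then show ?thesis by (simp add: var_def Zero_fract_def eq_fract)
qed

lemma specializes_var: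
  shows "a \<notin> S \<Longrightarrow> specializes S (var a) (var a)"
    and "a \<in> S \<Longrightarrow> specializes S (var a) 0"
proof -
  let ?m = "{#Abs_variable a#}"
  let ?A = "Poly_Mapping.single ?m (1::int)"
  have w: "weight S ?m = (if a \<in> S then 1 else 0)"
    by (simp add: weight_def Abs_variable_inverse)
  show "specializes S (var a) (var a)" if "a \<notin> S"
    unfolding var_def using that
    by (intro specializes_constant) (simp add: scale_single w monom_0)
  show "specializes S (var a) 0" if "a \<in> S"
  proof (rule specializesI[where k = 0])
    show "var a = Fract ?A 1" by (simp add: var_def)
    show "scale S ?A = [:0, 1:] ^ 0 * Polynomial.monom ?A 1"
      using that by (simp add: scale_single w)
    show "scale S 1 = [:0, 1:] ^ 0 * 1" by simp
  qed (simp_all add: poly_monom fract_collapse)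
qed

section \<open>The ring of functions\<close>

text \<open>For \<open>p = q\<close> the last condition says that the value at \<open>p\<close> is its own limit at \<open>p\<close>. Consequently
  a nonzero value at \<open>q\<close> is a unit of the valuation ring at \<open>q\<close>. Functions vanish outside \<open>X\<close> so that
  they are determined by their values on \<open>X\<close>.\<close>

definition hochster_functions :: "'a::complete_lattice set \<Rightarrow> ('a \<Rightarrow> 'a mpoly fract) set" where
  "hochster_functions X = {f. (\<forall>p. p \<notin> X \<longrightarrow> f p = 0) \<and>
     continuous_map (patch_topology X) (discrete_topology UNIV) f \<and>
     (\<forall>p\<in>X. \<forall>q\<in>X. p \<le> q \<longrightarrow> specializes {..q} (f p) (f q))}"

definition hochster_ring :: "'a::complete_lattice set \<Rightarrow> ('a \<Rightarrow> 'a mpoly fract) ring" where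
  "hochster_ring X = \<lparr>carrier = hochster_functions X,
     mult = (\<lambda>f g p. f p * g p), one = (\<lambda>p. if p \<in> X then 1 else 0),
     zero = (\<lambda>p. 0), add = (\<lambda>f g p. f p + g p)\<rparr>"

definition cozero :: "'a set \<Rightarrow> ('a \<Rightarrow> 'b::zero) \<Rightarrow> 'a set" where
  "cozero X f = {p \<in> X. f p \<noteq> 0}"

lemma continuous_map_discrete_compose2:
  assumes "continuous_map P (discrete_topology UNIV) f" "continuous_map P (discrete_topology UNIV) g"
  shows "continuous_map P (discrete_topology UNIV) (\<lambda>p. h (f p) (g p))"
proof -
  let ?fib = "\<lambda>f x. {p \<in> topspace P. f p \<in> {x}}"
  have "openin P (?fib f x)" "openin P (?fib g y)" for x y
    using openin_continuous_map_preimage[OF assms(1), of "{x}"]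
      openin_continuous_map_preimage[OF assms(2), of "{y}"] by simp_all
  then have "openin P (\<Union>(x, y)\<in>{(x, y). h x y \<in> U}. ?fib f x \<inter> ?fib g y)" for U
    by (intro openin_Union) (auto intro!: openin_Int)
  also have "(\<Union>(x, y)\<in>{(x, y). h x y \<in> U}. ?fib f x \<inter> ?fib g y) =
      {p \<in> topspace P. h (f p) (g p) \<in> U}" for U
    by auto
  finally have "openin P {p \<in> topspace P. h (f p) (g p) \<in> U}" for U .
  then show ?thesis by (simp add: continuous_map_def)
qed

context
  fixes X :: "'a::complete_lattice set"
  assumes X: "X \<subseteq> UNIV - {top_class.top}"
    and compact_patch: "compact_space (patch_topology X)"
begin

lemma hochster_functions_binop:
  assumes f: "f \<in> hochster_functions X" and g: "g \<in> hochster_functions X"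
    and h: "h 0 0 = 0" "\<And>S x y u v. specializes S x y \<Longrightarrow> specializes S u v \<Longrightarrow> specializes S (h x u) (h y v)"
  shows "(\<lambda>p. h (f p) (g p)) \<in> hochster_functions X"
  unfolding hochster_functions_def
proof (intro CollectI conjI allI ballI impI)
  show "h (f p) (g p) = 0" if "p \<notin> X" for p
    using f g h(1) that by (simp add: hochster_functions_def)
  show "continuous_map (patch_topology X) (discrete_topology UNIV) (\<lambda>p. h (f p) (g p))"
    by (rule continuous_map_discrete_compose2[of _ f g h])
      (use f g in \<open>simp_all add: hochster_functions_def\<close>)
  show "specializes {..q} (h (f p) (g p)) (h (f q) (g q))" if "p \<in> X" "q \<in> X" "p \<le> q" for p q
    using f g that by (intro h(2)) (simp_all add: hochster_functions_def)
qed

lemma hochster_functions_add: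
  "f \<in> hochster_functions X \<Longrightarrow> g \<in> hochster_functions X \<Longrightarrow> (\<lambda>p. f p + g p) \<in> hochster_functions X"
  by (rule hochster_functions_binop[where h = "(+)"]) (simp_all add: specializes_add)

lemma hochster_functions_mult:
  "f \<in> hochster_functions X \<Longrightarrow> g \<in> hochster_functions X \<Longrightarrow> (\<lambda>p. f p * g p) \<in> hochster_functions X"
  by (rule hochster_functions_binop[where h = "(*)"]) (simp_all add: specializes_mult)

lemma hochster_functions_uminus:
  "f \<in> hochster_functions X \<Longrightarrow> (\<lambda>p. - f p) \<in> hochster_functions X"
  by (rule hochster_functions_binop[of f f "\<lambda>x u. - x"]) (simp_all add: specializes_uminus)

lemma continuous_map_patch_if:
  assumes "openin (patch_topology X) A" "openin (patch_topology X) (X - A)" 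
  shows "continuous_map (patch_topology X) (discrete_topology UNIV) (\<lambda>p. if p \<in> A then c else d)"
proof -
  have top: "topspace (patch_topology X) = X" by (rule topspace_patch_topology[OF X])
  have "A \<subseteq> X" using openin_subset[OF assms(1)] top by simp
  then have "{p \<in> X. (if p \<in> A then c else d) \<in> U} = (if c \<in> U then A else {}) \<union> (if d \<in> U then X - A else {})" for U
    by auto
  moreover have "openin (patch_topology X) ((if c \<in> U then A else {}) \<union> (if d \<in> U then X - A else {}))" for U
    by (rule openin_Un) (use assms in simp_all)
  ultimately show ?thesis by (simp add: continuous_map_def top)
qed

lemma hochster_functions_of_nat:
  "(\<lambda>p. if p \<in> X then of_nat n else 0) \<in> hochster_functions X"
proof -
  have "openin (patch_topology X) X" 
    using openin_topspace[of "patch_topology X"] topspace_patch_topology[OF X] by simp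
  then have "continuous_map (patch_topology X) (discrete_topology UNIV)
      (\<lambda>p. if p \<in> X then (of_nat n :: 'a mpoly fract) else 0)"
    by (intro continuous_map_patch_if) auto
  then show ?thesis by (simp add: hochster_functions_def specializes_of_nat)
qed

lemma hochster_functions_zero: "(\<lambda>p. 0) \<in> hochster_functions X"
  and hochster_functions_one: "(\<lambda>p. if p \<in> X then 1 else 0) \<in> hochster_functions X"
  using hochster_functions_of_nat[of 0] hochster_functions_of_nat[of 1] by (simp_all cong: if_cong)

text \<open>These functions realize the subbase of the classical topology as cozero sets. Passing from
  \<open>p\<close> to \<open>q \<ge> p\<close>, the value \<open>T\<^sub>a\<close> drops to \<open>0\<close> exactly if \<open>a \<le> q\<close>, which is the case in which
  the limit at \<open>q\<close> sends \<open>T\<^sub>a\<close> to \<open>0\<close>.\<close>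

lemma hochster_functions_var:
  "(\<lambda>p. if p \<in> X - closed_V X a then var a else 0) \<in> hochster_functions X"
proof -
  have "X - (X - closed_V X a) = closed_V X a" by (auto simp: closed_V_def)
  then have "continuous_map (patch_topology X) (discrete_topology UNIV)
      (\<lambda>p. if p \<in> X - closed_V X a then var a else 0)"
    using patch_clopen_V[OF X, of a] by (intro continuous_map_patch_if) auto
  moreover have "specializes {..q} (if p \<in> X - closed_V X a then var a else 0)
      (if q \<in> X - closed_V X a then var a else 0)" if "p \<in> X" "q \<in> X" "p \<le> q" for p q
    using that specializes_var[of a "{..q}"] specializes_zero[of "{..q}"]
    by (auto simp: closed_V_def)
  ultimately show ?thesis by (auto simp: hochster_functions_def)
qed

lemma hochster_functions_finite_range:
  assumes "f \<in> hochster_functions X"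
  shows "finite (f ` X)"
proof -
  have "compactin (patch_topology X) X"
    using compact_patch topspace_patch_topology[OF X] by (simp add: compact_space_def)
  moreover have "continuous_map (patch_topology X) (discrete_topology UNIV) f"
    using assms by (simp add: hochster_functions_def)
  ultimately have "compactin (discrete_topology UNIV) (f ` X)" by (rule image_compactin)
  then show ?thesis by (simp add: compactin_discrete_topology)
qed

lemma cring_hochster_ring: "cring (hochster_ring X)"
proof (rule cringI)
  show "abelian_group (hochster_ring X)"
  proof (rule abelian_groupI)
    fix f assume f: "f \<in> carrier (hochster_ring X)"
    show "\<exists>g\<in>carrier (hochster_ring X). g \<oplus>\<^bsub>hochster_ring X\<^esub> f = \<zero>\<^bsub>hochster_ring X\<^esub>"
      using hochster_functions_uminus[of f] f
      by (intro bexI[of _ "\<lambda>p. - f p"]) (simp_all add: hochster_ring_def)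
  qed (simp_all add: hochster_ring_def hochster_functions_zero hochster_functions_add ac_simps)
  show "Group.comm_monoid (hochster_ring X)"
  proof (rule comm_monoidI)
    show "\<one>\<^bsub>hochster_ring X\<^esub> \<in> carrier (hochster_ring X)"
      by (simp add: hochster_ring_def hochster_functions_one)
    fix f assume "f \<in> carrier (hochster_ring X)"
    then show "\<one>\<^bsub>hochster_ring X\<^esub> \<otimes>\<^bsub>hochster_ring X\<^esub> f = f"
      by (auto simp: hochster_ring_def hochster_functions_def fun_eq_iff)
  qed (simp_all add: hochster_ring_def hochster_functions_mult ac_simps)
qed (simp add: hochster_ring_def distrib_right)

lemma cozero_patch_clopen:
  assumes f: "f \<in> hochster_functions X"
  shows "closedin (patch_topology X) (cozero X f)"
    and "closedin (patch_topology X) (X - cozero X f)"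
proof -
  have cont: "continuous_map (patch_topology X) (discrete_topology UNIV) f"
    using f by (simp add: hochster_functions_def)
  have "closedin (patch_topology X) {p \<in> topspace (patch_topology X). f p \<in> U}" for U
    using closedin_continuous_map_preimage[OF cont, of U] by simp
  from this[of "{0}"] this[of "- {0}"] show "closedin (patch_topology X) (cozero X f)"
    and "closedin (patch_topology X) (X - cozero X f)"
    unfolding topspace_patch_topology[OF X] cozero_def by (simp_all add: set_diff_eq conj_commute cong: conj_cong)
qed

text \<open>If \<open>f p = 0\<close> and \<open>p \<le> q\<close>, then \<open>f q\<close> is a limit of \<open>0\<close>. So cozero sets are closed under passing to
  smaller points, as classical open sets must be.\<close>

lemma cozero_open:
  assumes f: "f \<in> hochster_functions X"
  shows "openin (classical_zariski_topology X) (cozero X f)"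
proof (rule openin_classical_if_patch_closed_complement[OF X compact_patch])
  show "closedin (patch_topology X) (X - cozero X f)" by (rule cozero_patch_clopen(2)[OF f])
  show "p \<in> cozero X f" if "p \<in> X" "q \<in> cozero X f" "p \<le> q" for p q
  proof -
    have "specializes {..q} (f p) (f q)" "f q \<noteq> 0" "q \<in> X"
      using that f by (auto simp: hochster_functions_def cozero_def)
    then show ?thesis using that(1) specializes_zero_iff[of "{..q}" "f q"] by (auto simp: cozero_def)
  qed
qed (auto simp: cozero_def)

text \<open>Let \<open>p \<le> q\<close>. If \<open>g q \<noteq> 0\<close>, then limits can be divided. If \<open>g q = 0\<close>, then \<open>f q = 0\<close> by
  hypothesis, so \<open>f p\<close> has positive order at \<open>q\<close>, and a large power of it outweighs \<open>g p\<close>. One exponent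
  suffices because \<open>g\<close> has finitely many values. Where \<open>g\<close> vanishes, the quotient is \<open>0\<close> since
  division by \<open>0\<close> yields \<open>0\<close>.\<close>

lemma hochster_functions_power_divide:
  assumes f: "f \<in> hochster_functions X" and g: "g \<in> hochster_functions X"
    and sub: "cozero X f \<subseteq> cozero X g"
  shows "\<exists>n>0. (\<lambda>p. f p ^ n / g p) \<in> hochster_functions X"
proof -
  define bound where "bound y N \<longleftrightarrow> (\<forall>n>N. \<forall>S x. specializes S x 0 \<longrightarrow> specializes S (x ^ n / y) 0)"
    for y :: "'a mpoly fract" and N
  have "\<forall>y. y \<noteq> 0 \<longrightarrow> (\<exists>N. bound y N)"
    using eventually_power_divide_specializes_zero unfolding bound_def by blast
  then obtain N where N: "bound y (N y)" if "y \<noteq> 0" for y by metis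
  define n where "n = Suc (Max (insert 0 (N ` g ` X)))"
  have n: "N (g p) < n" if "p \<in> X" for p
    unfolding n_def less_Suc_eq_le
    by (rule Max_ge) (use that hochster_functions_finite_range[OF g] in auto)
  have pow: "specializes S (x ^ m) (y ^ m)" if "specializes S x y" for S m and x y :: "'a mpoly fract"
    by (induction m) (use that in \<open>auto intro: specializes_one specializes_mult\<close>)
  have "specializes {..q} (f p ^ n / g p) (f q ^ n / g q)" if pq: "p \<in> X" "q \<in> X" "p \<le> q" for p q
  proof -
    have fpq: "specializes {..q} (f p) (f q)" and gpq: "specializes {..q} (g p) (g q)"
      using f g pq by (auto simp: hochster_functions_def)
    show ?thesis
    proof (cases "g q = 0")
      case False
      show ?thesis unfolding divide_inverse
        by (intro specializes_mult specializes_inverse pow fpq gpq False)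
    next
      case True
      then have fq: "f q = 0" using sub pq by (auto simp: cozero_def)
      show ?thesis
      proof (cases "g p = 0")
        case True
        then show ?thesis using \<open>g q = 0\<close> by (simp add: specializes_zero)
      next
        case False
        then have "specializes {..q} (f p ^ n / g p) 0"
          using N[of "g p"] n[OF pq(1)] fpq fq unfolding bound_def by metis
        then show ?thesis using \<open>g q = 0\<close> by simp
      qed
    qed
  qed
  moreover have "continuous_map (patch_topology X) (discrete_topology UNIV) (\<lambda>p. f p ^ n / g p)"
    using f g by (intro continuous_map_discrete_compose2[of _ f g "\<lambda>x y. x ^ n / y"])
      (auto simp: hochster_functions_def)
  ultimately have "(\<lambda>p. f p ^ n / g p) \<in> hochster_functions X"
    using f g by (auto simp: hochster_functions_def n_def)
  moreover have "n > 0" by (simp add: n_def)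
  ultimately show ?thesis by blast
qed

lemma inj_of_nat_fract: "inj (of_nat :: nat \<Rightarrow> 'a mpoly fract)"
  by (rule injI) (simp add: of_nat_fract eq_fract)

text \<open>If \<open>f p + n g p = 0\<close> although \<open>f p\<close> and \<open>g p\<close> do not both vanish, then \<open>g p \<noteq> 0\<close> and
  \<open>n = - f p / g p\<close>. The functions have finitely many values and \<open>F\<close> has characteristic \<open>0\<close>, so some
  \<open>n\<close> avoids this.\<close>

lemma cozero_join:
  assumes f: "f \<in> hochster_functions X" and g: "g \<in> hochster_functions X"
  shows "\<exists>n::nat. cozero X (\<lambda>p. f p + of_nat n * g p) = cozero X f \<union> cozero X g"
proof -
  define B where "B = (\<lambda>(x, y). - x / y) ` (f ` X \<times> g ` X)"
  have "finite B"
    unfolding B_def using hochster_functions_finite_range f g by blast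
  moreover have "infinite (range (of_nat :: nat \<Rightarrow> 'a mpoly fract))"
    using inj_of_nat_fract finite_imageD by (metis infinite_UNIV_nat)
  ultimately obtain c where c: "c \<in> range (of_nat :: nat \<Rightarrow> 'a mpoly fract)" "c \<notin> B"
    by (meson finite_subset subsetI)
  then obtain n where n: "c = of_nat n" by auto
  have "f p + c * g p = 0 \<longleftrightarrow> f p = 0 \<and> g p = 0" if "p \<in> X" for p
  proof (cases "g p = 0")
    case False
    have "- f p / g p \<noteq> c" using that c(2) by (auto simp: B_def)
    then show ?thesis using False by (auto simp: field_simps add_eq_0_iff2)
  qed simp
  then have "cozero X (\<lambda>p. f p + c * g p) = cozero X f \<union> cozero X g" by (auto simp: cozero_def)
  then show ?thesis using n by blast
qed

lemma hochster_ring_pow: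
  assumes "f \<in> hochster_functions X"
  shows "f [^]\<^bsub>hochster_ring X\<^esub> (n::nat) = (\<lambda>p. if p \<in> X then f p ^ n else 0)"
proof (induction n)
  case (Suc n)
  then show ?case using assms
    by (auto simp: hochster_ring_def hochster_functions_def fun_eq_iff)
qed (simp add: hochster_ring_def fun_eq_iff)

lemma ring_support_hochster_ring:
  "ring_support (hochster_ring X) (cozero X) (classical_zariski_topology X) (patch_topology X)"
proof -
  note top = topspace_classical_zariski_topology[OF X]
  have carrier: "carrier (hochster_ring X) = hochster_functions X" by (simp add: hochster_ring_def)
  have var: "cozero X (\<lambda>p. if p \<in> X - closed_V X a then var a else 0) = X - closed_V X a" for a
    by (auto simp: cozero_def var_nonzero)
  show ?thesis
  proof (intro ring_support.intro ring_support_axioms.intro cring_hochster_ring compact_patch, unfold carrier top)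
    show "cozero X \<zero>\<^bsub>hochster_ring X\<^esub> = {}" "cozero X \<one>\<^bsub>hochster_ring X\<^esub> = X"
      by (auto simp: hochster_ring_def cozero_def)
  next
    fix f g assume f: "f \<in> hochster_functions X" and g: "g \<in> hochster_functions X"
    show "cozero X (f \<otimes>\<^bsub>hochster_ring X\<^esub> g) = cozero X f \<inter> cozero X g"
      "cozero X (f \<oplus>\<^bsub>hochster_ring X\<^esub> g) \<subseteq> cozero X f \<union> cozero X g"
      by (auto simp: hochster_ring_def cozero_def)
    show "\<exists>n::nat. \<exists>h\<in>hochster_functions X. f [^]\<^bsub>hochster_ring X\<^esub> n = g \<otimes>\<^bsub>hochster_ring X\<^esub> h"
      if sub: "cozero X f \<subseteq> cozero X g"
    proof -
      obtain n where n: "n > 0" "(\<lambda>p. f p ^ n / g p) \<in> hochster_functions X"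
        using hochster_functions_power_divide[OF f g sub] by blast
      have "(if p \<in> X then f p ^ n else 0) = g p * (f p ^ n / g p)" for p
      proof (cases "p \<in> X \<and> g p \<noteq> 0")
        case False
        then have "f p = 0" "g p = 0" using f g sub by (auto simp: hochster_functions_def cozero_def)
        then show ?thesis using n(1) by simp
      qed simp
      then have "f [^]\<^bsub>hochster_ring X\<^esub> n = g \<otimes>\<^bsub>hochster_ring X\<^esub> (\<lambda>p. f p ^ n / g p)"
        unfolding hochster_ring_pow[OF f] by (simp add: hochster_ring_def fun_eq_iff)
      then show ?thesis using n(2) by blast
    qed
    show "\<exists>c\<in>hochster_functions X. cozero X (f \<oplus>\<^bsub>hochster_ring X\<^esub> c \<otimes>\<^bsub>hochster_ring X\<^esub> g) =
        cozero X f \<union> cozero X g"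
    proof -
      obtain n :: nat where n: "cozero X (\<lambda>p. f p + of_nat n * g p) = cozero X f \<union> cozero X g"
        using cozero_join[OF f g] by blast
      have "cozero X (f \<oplus>\<^bsub>hochster_ring X\<^esub> (\<lambda>p. if p \<in> X then of_nat n else 0) \<otimes>\<^bsub>hochster_ring X\<^esub> g) =
          cozero X (\<lambda>p. f p + of_nat n * g p)"
        by (auto simp: hochster_ring_def cozero_def)
      then show ?thesis using n by (intro bexI[OF _ hochster_functions_of_nat[of n]]) simp
    qed
  next
    fix f assume "f \<in> hochster_functions X"
    then show "openin (classical_zariski_topology X) (cozero X f)"
      "closedin (patch_topology X) (cozero X f)" "closedin (patch_topology X) (X - cozero X f)"
      by (auto intro: cozero_open cozero_patch_clopen)
  next
    fix U p assume "openin (classical_zariski_topology X) U" "p \<in> U"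
    then have "generate_topology_on {X - closed_V X a | a. True} U" "p \<in> U"
      unfolding classical_zariski_topology_def openin_topology_generated_by_iff by auto
    then show "\<exists>f\<in>hochster_functions X. p \<in> cozero X f \<and> cozero X f \<subseteq> U"
    proof (induction U rule: generate_topology_on.induct)
      case (Int U V)
      then obtain f g where fg: "f \<in> hochster_functions X" "g \<in> hochster_functions X"
        "p \<in> cozero X f" "cozero X f \<subseteq> U" "p \<in> cozero X g" "cozero X g \<subseteq> V" by (meson IntD1 IntD2)
      have "cozero X (\<lambda>p. f p * g p) = cozero X f \<inter> cozero X g" by (auto simp: cozero_def)
      then show ?case
        using fg by (intro bexI[OF _ hochster_functions_mult[OF fg(1,2)]]) auto
    next
      case (UN K)
      then show ?case by (meson Union_iff Union_upper subset_trans)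
    next
      case (Basis U)
      then obtain a where "U = X - closed_V X a" by blast
      then show ?case
        using Basis(2) var[of a] by (intro bexI[OF _ hochster_functions_var[of a]]) simp
    qed simp
  next
    fix p q assume pq: "p \<in> X" "q \<in> X" "p \<noteq> q"
    then obtain a where "(a \<le> p) \<noteq> (a \<le> q)" by (metis order.antisym order.refl)
    then have "(p \<in> X - closed_V X a) \<noteq> (q \<in> X - closed_V X a)"
      using pq by (auto simp: closed_V_def)
    then show "\<exists>f\<in>hochster_functions X. (p \<in> cozero X f) \<noteq> (q \<in> cozero X f)"
      using var[of a] by (intro bexI[OF _ hochster_functions_var[of a]]) metis
  qed
qed

end

section \<open>Encoding functions as sets of words\<close>

text \<open>Each word in the variables contributes itself, preceded by a number for the coefficient of the
  monomial that it spells. All words spelling a monomial are listed, so no choice is involved.\<close>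

definition mpoly_code :: "'a mpoly \<Rightarrow> ('a + nat) list set" where
  "mpoly_code A = range (\<lambda>w. Inr (int_encode (Poly_Mapping.lookup A (mset w))) # map (Inl \<circ> Rep_variable) w)"

lemma inj_mpoly_code: "inj mpoly_code"
proof (rule injI, rule poly_mapping_eqI)
  fix A B :: "'a mpoly" and m :: "'a variable multiset"
  assume eq: "mpoly_code A = mpoly_code B"
  obtain w where w: "mset w = m" using ex_mset by blast
  have "Inr (int_encode (Poly_Mapping.lookup A (mset w))) # map (Inl \<circ> (Rep_variable :: _ \<Rightarrow> 'a)) w \<in> mpoly_code B"
    unfolding eq[symmetric] unfolding mpoly_code_def by blast
  then obtain v where v: "int_encode (Poly_Mapping.lookup A (mset w)) = int_encode (Poly_Mapping.lookup B (mset v))"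
    "map (Inl \<circ> Rep_variable :: _ \<Rightarrow> 'a + nat) w = map (Inl \<circ> Rep_variable) v"
    unfolding mpoly_code_def by auto
  have "inj (Inl \<circ> Rep_variable :: 'a variable \<Rightarrow> 'a + nat)"
    by (rule injI) (simp add: Rep_variable_inject)
  then have "w = v" using v(2) by (simp add: inj_map_eq_map)
  then show "Poly_Mapping.lookup A m = Poly_Mapping.lookup B m"
    using v(1) w by (simp add: int_encode_eq)
qed

text \<open>The codes of a numerator and a denominator are kept apart by a leading tag.\<close>

definition fract_code :: "'a mpoly fract \<Rightarrow> ('a + nat) list set" where
  "fract_code x = (let (A, B) = (SOME (A, B). x = Fract A B)
     in Cons (Inr 0) ` mpoly_code A \<union> Cons (Inr 1) ` mpoly_code B)"

lemma inj_fract_code: "inj fract_code"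
proof (rule injI)
  fix x y :: "'a mpoly fract"
  assume eq: "fract_code x = fract_code y"
  have repr: "\<exists>A B. z = Fract A B \<and> fract_code z = Cons (Inr 0) ` mpoly_code A \<union> Cons (Inr 1) ` mpoly_code B"
    for z :: "'a mpoly fract"
  proof -
    obtain A B where AB: "(SOME (A, B). z = Fract A B) = (A, B)" by fastforce
    have "\<exists>P. case P of (A, B) \<Rightarrow> z = Fract A B" by (cases z) auto
    from someI_ex[OF this] have "z = Fract A B" unfolding AB by simp
    then show ?thesis unfolding fract_code_def AB by auto
  qed
  obtain A B where x: "x = Fract A B" "fract_code x = Cons (Inr 0) ` mpoly_code A \<union> Cons (Inr 1) ` mpoly_code B"
    using repr by blast
  obtain C E where y: "y = Fract C E" "fract_code y = Cons (Inr 0) ` mpoly_code C \<union> Cons (Inr 1) ` mpoly_code E"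
    using repr by blast
  have parts: "{w. Inr 0 # w \<in> Cons (Inr 0) ` M \<union> Cons (Inr 1) ` N} = M"
    "{w. Inr 1 # w \<in> Cons (Inr 0) ` M \<union> Cons (Inr 1) ` N} = N"
    for M N :: "('a + nat) list set" by auto
  have "mpoly_code A = mpoly_code C" "mpoly_code B = mpoly_code E"
    using parts x(2) y(2) eq by metis+
  then show "x = y" using x(1) y(1) inj_mpoly_code by (metis injD)
qed

definition function_code :: "('a \<Rightarrow> 'a mpoly fract) \<Rightarrow> ('a + nat) list set" where
  "function_code f = (\<Union>p. Cons (Inl p) ` fract_code (f p))"

lemma inj_function_code: "inj function_code"
proof (rule injI, rule ext)
  fix f g :: "'a \<Rightarrow> 'a mpoly fract" and p :: 'a
  assume eq: "function_code f = function_code g"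
  have "{w. Inl p # w \<in> function_code h} = fract_code (h p)" for h
    by (auto simp: function_code_def)
  then have "fract_code (f p) = fract_code (g p)" using eq by metis
  then show "f p = g p" using inj_fract_code by (metis injD)
qed

section \<open>Compact patch topology implies spectral\<close>

theorem proposition1p49:
  fixes X :: "'a::complete_lattice set"
  assumes "X \<subseteq> UNIV - {top_class.top}"
    and "compact_space (patch_topology X)"
  shows "spectral_space (classical_zariski_topology X)"
proof -
  let ?R = "image_ring function_code (hochster_ring X)"
  interpret R: ring_support "hochster_ring X" "cozero X" "classical_zariski_topology X" "patch_topology X"
    by (rule ring_support_hochster_ring[OF assms])
  have "inj_on function_code (carrier (hochster_ring X))"
    using inj_function_code by (rule inj_on_subset) simp
  from R.ring_support_image_ring[OF this]
  interpret S: ring_support ?R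
    "\<lambda>s. cozero X (inv_into (carrier (hochster_ring X)) function_code s)"
    "classical_zariski_topology X" "patch_topology X" .
  show ?thesis
    unfolding spectral_space_def using S.is_cring S.homeomorphic_space_zariski by blast
qed

end
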